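(* Consider the block-Markov random code described in the context, with $B$ blocks of length $n$, rate $R$, typicality parameter $\varepsilon$, and $\delta>0$. For each block $b\in\{2,\dots,B\}$ and for each previous message $m_{b-1}$ (the index used in block $b-1$), with $m=m_b$ the index used in block $b$: if $R\leq I(X;Y|Y')-\delta$, then for all $\varepsilon>0$ there exists $N_0\in\mathbb{N}$ such that for all $n\geq N_0$, $$\mathbb{E}_c\Big\{\mathbb{P}\big(\exists\,\tilde m\neq m\ \text{ s.t. }\ A_b(\tilde m)\cap B_{b-1}(\tilde m)\big)\Big\}\leq\varepsilon,$$ where $$A_b(\tilde m)=\{(Y_b^n,X^n(\tilde m))\in\mathcal{T}_\varepsilon^{(n)}(\mathcal{P}_{Y'XY})\},$$ $$B_{b-1}(\tilde m)=\{(Y_{b-1}^n,X^n(m_{b-1}),W^n(m_{b-1},\tilde m))\in\mathcal{T}_\varepsilon^{(n)}(\mathcal{P}_{WY'XY})\}.$$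
   Context: Setting. $\mathcal{U},\mathcal{X},\mathcal{W},\mathcal{Y},\mathcal{V}$ are finite alphabets; $\mathcal{P}_U$ is a source distribution; $\mathcal{W}_{Y|X,Y'}(y|x,y')$ is a Markov channel kernel (probability of new state $y$ given input $x$ and previous state $y'$) such that for every input distribution $\mathcal{P}_X$ the Markov chain on $\mathcal{Y}$ with transition matrix $\sum_x\mathcal{P}_X(x)\mathcal{W}_{Y|X,Y'}(y|x,y')$ has a unique recurrent class, which is irreducible and aperiodic; $\pi$ denotes its unique equilibrium distribution. Fix a joint distribution of $(U,X,W,Y',Y,V)$ of the form $\mathcal{P}_U\mathcal{P}_X\mathcal{P}_{W|U,X}\pi_{Y'}\mathcal{W}_{Y|X,Y'}\mathcal{P}_{V|Y,X,W}$ satisfying $I(X;Y|Y')-I(U;W|X)\geq0$, and $\delta>0$, $R>0$ with $R\geq I(U;W|X)+\delta$ and $R\leq I(X;Y|Y')-\delta$. All marginals $\mathcal{P}_{U,X,W}$, $\mathcal{P}_{W|X}$, $\mathcal{P}_{Y'XY}$, $\mathcal{P}_{WY'XY}$ and information quantities are those of this joint distribution. Random codebook. $|\mathcal{M}|=2^{nR}$ sequences $X^n(m)$, $m\in\mathcal{M}$, are drawn independently from $\mathcal{P}_X^{\otimes n}$; for each $m\in\mathcal{M}$, $2^{nR}$ sequences $W^n(m,\hat m)$, $\hat m\in\mathcal{M}$, are drawn from $\mathcal{P}_{W|X}^{\otimes n}$ conditioned on $X^n(m)$. $\mathbb{E}_c$ is the expectation over the random codebook. Encoding. The source blocks $U_b^n$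 are i.i.d. $\sim\mathcal{P}_U$ within and across blocks. In block 1, $m_1=1$ and $X^n(m_1)$ is sent. At the beginning of block $b\in\{2,\dots,B\}$, the encoder, knowing $U_{b-1}^n$ and $m_{b-1}$, finds an index $m_b$ such that $(U_{b-1}^n,X^n(m_{b-1}),W^n(m_{b-1},m_b))\in\mathcal{T}_\varepsilon^{(n)}(\mathcal{P}_{U,X,W})$ (ties, and the case where no such index exists, being resolved by an arbitrary fixed rule), and sends $X_b^n=X^n(m_b)$ in block $b$. Channel. In block $b$, the outputs are generated sequentially: $Y_{b,1}\sim\mathcal{W}_{Y|X,Y'}(\cdot|X_{b,1},Y_{b-1,n})$, where $Y_{b-1,n}$ is the last output of block $b-1$, and $Y_{b,t}\sim\mathcal{W}_{Y|X,Y'}(\cdot|X_{b,t},Y_{b,t-1})$ for $t=2,\dots,n$; the starting state of the whole transmission is arbitrary. Typicality. $\mathcal{T}_\varepsilon^{(n)}(\mathcal{P}_{U,X,W})$ is the set of triples of sequences whose joint empirical distribution is within $\ell_1$ distance $\varepsilon$ of $\mathcal{P}_{U,X,W}$. For sequences $(x^n,y^n)$ with starting state $y_0$, $(x^n,y^n)\in\mathcal{T}_\varepsilon^{(n)}(\mathcal{P}_{Y'XY})$ means that the empirical distribution $\frac1n\sum_{t=1}^n\mathbf{1}\{(y_{t-1},x_t,y_t)=(i,x,j)\}$ is within $\ell_1$ distance $\varepsilon$ of $\mathcal{P}_{Y'XY}$; $\mathcal{T}_\varepsilon^{(n)}(\mathcal{P}_{WY'XY})$ is defined in the same way with the quadruples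 $(w_t,y_{t-1},x_t,y_t)$. In block $b$ the starting state is $Y_{b-1,n}$.
   Formalization: The typicality parameter must be at most some ε₀>0 and is separate from the error bound, which is any η>0 (false for large ε: noiseless binary channel, R=0.9, ε=0.5); the index-selection rule may not inspect codebook rows other than that of m_{b-1}. *)

theory Defs
  imports "HOL-Probability.Probability"
begin

section \<open>Finite Markov chains\<close>

text \<open>A transition matrix is a kernel \<open>K\<close>, where \<open>pmf (K i) j\<close> is the probability of moving
  from \<open>i\<close> to \<open>j\<close>.\<close>

primrec nstep :: "('y \<Rightarrow> 'y pmf) \<Rightarrow> nat \<Rightarrow> 'y \<Rightarrow> 'y pmf" where
  "nstep K 0 i = return_pmf i"
| "nstep K (Suc n) i = bind_pmf (nstep K n i) K"

definition accessible :: "('y \<Rightarrow> 'y pmf) \<Rightarrow> 'y \<Rightarrow> 'y \<Rightarrow> bool" where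
  "accessible K i j \<longleftrightarrow> (\<exists>n. pmf (nstep K n i) j > 0)"

text \<open>The probability that, starting in \<open>i\<close>, the first visit to \<open>j\<close> after time 0 occurs at
  time \<open>n + 1\<close>.\<close>

primrec first_passage :: "('y::finite \<Rightarrow> 'y pmf) \<Rightarrow> 'y \<Rightarrow> nat \<Rightarrow> 'y \<Rightarrow> real" where
  "first_passage K j 0 i = pmf (K i) j"
| "first_passage K j (Suc n) i = (\<Sum>k\<in>UNIV - {j}. pmf (K i) k * first_passage K j n k)"

definition recurrent :: "('y::finite \<Rightarrow> 'y pmf) \<Rightarrow> 'y \<Rightarrow> bool" where
  "recurrent K i \<longleftrightarrow> (\<lambda>n. first_passage K i n i) sums 1"

definition recurrent_classes :: "('y::finite \<Rightarrow> 'y pmf) \<Rightarrow> 'y set set" where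
  "recurrent_classes K = {{j. accessible K i j \<and> accessible K j i} | i. recurrent K i}"

definition irreducible_class :: "('y \<Rightarrow> 'y pmf) \<Rightarrow> 'y set \<Rightarrow> bool" where
  "irreducible_class K C \<longleftrightarrow> (\<forall>i\<in>C. \<forall>j\<in>C. accessible K i j)"

definition aperiodic_class :: "('y \<Rightarrow> 'y pmf) \<Rightarrow> 'y set \<Rightarrow> bool" where
  "aperiodic_class K C \<longleftrightarrow> (\<forall>i\<in>C. Gcd {n. n > 0 \<and> pmf (nstep K n i) i > 0} = 1)"

definition unichain :: "('y::finite \<Rightarrow> 'y pmf) \<Rightarrow> bool" where
  "unichain K \<longleftrightarrow>
     (\<exists>C. recurrent_classes K = {C} \<and> irreducible_class K C \<and> aperiodic_class K C)"

definition equilibrium :: "('y \<Rightarrow> 'y pmf) \<Rightarrow> 'y pmf \<Rightarrow> bool" where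
  "equilibrium K \<pi> \<longleftrightarrow> bind_pmf \<pi> K = \<pi>"


section \<open>Single-letter distributions\<close>

text \<open>For a Markov channel \<open>Ch\<close>, the distribution \<open>Ch x y'\<close> is that of the new state when the
  input is \<open>x\<close> and the previous state is \<open>y'\<close>.\<close>

definition mean_kernel :: "('x \<Rightarrow> 'y \<Rightarrow> 'y pmf) \<Rightarrow> 'x pmf \<Rightarrow> 'y \<Rightarrow> 'y pmf" where
  "mean_kernel Ch PX y' = bind_pmf PX (\<lambda>x. Ch x y')"

type_synonym ('u, 'x, 'w, 'y, 'v) letters = "'u \<times> 'x \<times> 'w \<times> 'y \<times> 'y \<times> 'v"

text \<open>The six components are \<open>(U, X, W, Y', Y, V)\<close>.\<close>

definition joint_pmf ::
    "'u pmf \<Rightarrow> 'x pmf \<Rightarrow> ('u \<Rightarrow> 'x \<Rightarrow> 'w pmf) \<Rightarrow> 'y pmf \<Rightarrow> ('x \<Rightarrow> 'y \<Rightarrow> 'y pmf) \<Rightarrow>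
     ('y \<Rightarrow> 'x \<Rightarrow> 'w \<Rightarrow> 'v pmf) \<Rightarrow> ('u, 'x, 'w, 'y, 'v) letters pmf" where
  "joint_pmf PU PX PW \<pi> Ch PV =
     do { u \<leftarrow> PU; x \<leftarrow> PX; w \<leftarrow> PW u x; y' \<leftarrow> \<pi>; y \<leftarrow> Ch x y'; v \<leftarrow> PV y x w;
          return_pmf (u, x, w, y', y, v) }"

definition pr_U :: "('u, 'x, 'w, 'y, 'v) letters \<Rightarrow> 'u" where "pr_U = (\<lambda>(u, x, w, y', y, v). u)"
definition pr_X :: "('u, 'x, 'w, 'y, 'v) letters \<Rightarrow> 'x" where "pr_X = (\<lambda>(u, x, w, y', y, v). x)"
definition pr_W :: "('u, 'x, 'w, 'y, 'v) letters \<Rightarrow> 'w" where "pr_W = (\<lambda>(u, x, w, y', y, v). w)"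
definition pr_Y' :: "('u, 'x, 'w, 'y, 'v) letters \<Rightarrow> 'y" where "pr_Y' = (\<lambda>(u, x, w, y', y, v). y')"
definition pr_Y :: "('u, 'x, 'w, 'y, 'v) letters \<Rightarrow> 'y" where "pr_Y = (\<lambda>(u, x, w, y', y, v). y)"

text \<open>Conditional mutual information \<open>I(X;Y|Z)\<close> in bits, for discrete random variables.\<close>

definition cond_info :: "'a pmf \<Rightarrow> ('a \<Rightarrow> 'b) \<Rightarrow> ('a \<Rightarrow> 'c) \<Rightarrow> ('a \<Rightarrow> 'd) \<Rightarrow> real" where
  "cond_info J X Y Z =
     prob_space.conditional_mutual_information (measure_pmf J) 2
       (count_space UNIV) (count_space UNIV) (count_space UNIV) X Y Z"

text \<open>The conditional distribution of \<open>W\<close> given \<open>X = x\<close>. It is unspecified when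
  \<open>X = x\<close> has probability 0; such an \<open>x\<close> occurs in no codeword.\<close>

definition P_W_given_X :: "('u, 'x, 'w, 'y, 'v) letters pmf \<Rightarrow> 'x \<Rightarrow> 'w pmf" where
  "P_W_given_X J x = map_pmf pr_W (cond_pmf J {z. pr_X z = x})"


section \<open>Typicality\<close>

text \<open>A sequence of length \<open>n\<close> is a function on \<open>nat\<close> of which only the values at \<open>1, \<dots>, n\<close>
  matter. A channel output sequence in addition carries its starting state at \<open>0\<close>.\<close>

definition empirical :: "nat \<Rightarrow> (nat \<Rightarrow> 'a) \<Rightarrow> 'a \<Rightarrow> real" where
  "empirical n f a = real (card {t \<in> {1..n}. f t = a}) / real n"

definition typical :: "nat \<Rightarrow> real \<Rightarrow> 'a::finite pmf \<Rightarrow> (nat \<Rightarrow> 'a) \<Rightarrow> bool" where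
  "typical n \<epsilon> P f \<longleftrightarrow> (\<Sum>a\<in>UNIV. \<bar>empirical n f a - pmf P a\<bar>) \<le> \<epsilon>"

definition typical_UXW :: "('u::finite, 'x::finite, 'w::finite, 'y, 'v) letters pmf \<Rightarrow>
    nat \<Rightarrow> real \<Rightarrow> (nat \<Rightarrow> 'u) \<Rightarrow> (nat \<Rightarrow> 'x) \<Rightarrow> (nat \<Rightarrow> 'w) \<Rightarrow> bool" where
  "typical_UXW J n \<epsilon> u x w \<longleftrightarrow>
     typical n \<epsilon> (map_pmf (\<lambda>z. (pr_U z, pr_X z, pr_W z)) J) (\<lambda>t. (u t, x t, w t))"

definition typical_Y'XY :: "('u, 'x::finite, 'w, 'y::finite, 'v) letters pmf \<Rightarrow>
    nat \<Rightarrow> real \<Rightarrow> (nat \<Rightarrow> 'x) \<Rightarrow> (nat \<Rightarrow> 'y) \<Rightarrow> bool" where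
  "typical_Y'XY J n \<epsilon> x y \<longleftrightarrow>
     typical n \<epsilon> (map_pmf (\<lambda>z. (pr_Y' z, pr_X z, pr_Y z)) J) (\<lambda>t. (y (t - 1), x t, y t))"

definition typical_WY'XY :: "('u, 'x::finite, 'w::finite, 'y::finite, 'v) letters pmf \<Rightarrow>
    nat \<Rightarrow> real \<Rightarrow> (nat \<Rightarrow> 'w) \<Rightarrow> (nat \<Rightarrow> 'x) \<Rightarrow> (nat \<Rightarrow> 'y) \<Rightarrow> bool" where
  "typical_WY'XY J n \<epsilon> w x y \<longleftrightarrow>
     typical n \<epsilon> (map_pmf (\<lambda>z. (pr_W z, pr_Y' z, pr_X z, pr_Y z)) J)
       (\<lambda>t. (w t, y (t - 1), x t, y t))"


section \<open>Random codebook\<close>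

text \<open>The number of messages is \<open>2 powr (n R)\<close>, rounded up to an integer.\<close>

definition messages :: "real \<Rightarrow> nat \<Rightarrow> nat set" where
  "messages R n = {1..nat \<lceil>2 powr (real n * R)\<rceil>}"

text \<open>Row \<open>m\<close> of a codebook consists of the codeword \<open>X\<^sup>n(m)\<close> and of the codewords
  \<open>W\<^sup>n(m, m')\<close> for all messages \<open>m'\<close>.\<close>

type_synonym ('x, 'w) row = "(nat \<Rightarrow> 'x) \<times> (nat \<Rightarrow> nat \<Rightarrow> 'w)"
type_synonym ('x, 'w) codebook = "nat \<Rightarrow> ('x, 'w) row"

definition cb_X :: "('x, 'w) codebook \<Rightarrow> nat \<Rightarrow> nat \<Rightarrow> 'x" where
  "cb_X c m = fst (c m)"

definition cb_W :: "('x, 'w) codebook \<Rightarrow> nat \<Rightarrow> nat \<Rightarrow> nat \<Rightarrow> 'w" where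
  "cb_W c m m' = snd (c m) m'"

definition row_pmf ::
    "'x pmf \<Rightarrow> ('u, 'x, 'w, 'y, 'v) letters pmf \<Rightarrow> real \<Rightarrow> nat \<Rightarrow> ('x, 'w) row pmf" where
  "row_pmf PX J R n =
     do { x \<leftarrow> Pi_pmf {1..n} undefined (\<lambda>_. PX);
          w \<leftarrow> Pi_pmf (messages R n) undefined
                 (\<lambda>_. Pi_pmf {1..n} undefined (\<lambda>t. P_W_given_X J (x t)));
          return_pmf (x, w) }"

definition codebook_pmf ::
    "'x pmf \<Rightarrow> ('u, 'x, 'w, 'y, 'v) letters pmf \<Rightarrow> real \<Rightarrow> nat \<Rightarrow> ('x, 'w) codebook pmf" where
  "codebook_pmf PX J R n = Pi_pmf (messages R n) undefined (\<lambda>_. row_pmf PX J R n)"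


section \<open>Encoding\<close>

text \<open>A selection rule picks the next message from the set \<open>S\<close> of admissible ones. It may use
  the data from which the encoder computes \<open>S\<close>: the block length, the previous message
  \<open>m\<close>, the source block \<open>u\<close> and row \<open>m\<close> of the codebook. It may not use the other rows of
  the codebook.\<close>

type_synonym ('u, 'x, 'w) rule =
  "nat \<Rightarrow> nat \<Rightarrow> (nat \<Rightarrow> 'u) \<Rightarrow> ('x, 'w) row \<Rightarrow> nat set \<Rightarrow> nat"

definition valid_rule :: "real \<Rightarrow> ('u, 'x, 'w) rule \<Rightarrow> bool" where
  "valid_rule R rule \<longleftrightarrow>
     (\<forall>n m u r S. S \<subseteq> messages R n \<longrightarrow>
        rule n m u r S \<in> (if S = {} then messages R n else S))"

definition admissible ::
    "('u::finite, 'x::finite, 'w::finite, 'y, 'v) letters pmf \<Rightarrow> real \<Rightarrow> nat \<Rightarrow> real \<Rightarrow>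
     ('x, 'w) codebook \<Rightarrow> nat \<Rightarrow> (nat \<Rightarrow> 'u) \<Rightarrow> nat set" where
  "admissible J R n \<epsilon> c m u =
     {m' \<in> messages R n. typical_UXW J n \<epsilon> u (cb_X c m) (cb_W c m m')}"

definition encode ::
    "('u::finite, 'x::finite, 'w::finite, 'y, 'v) letters pmf \<Rightarrow> real \<Rightarrow> nat \<Rightarrow> real \<Rightarrow>
     ('u, 'x, 'w) rule \<Rightarrow> ('x, 'w) codebook \<Rightarrow> nat \<Rightarrow> (nat \<Rightarrow> 'u) \<Rightarrow> nat" where
  "encode J R n \<epsilon> rule c m u = rule n m u (c m) (admissible J R n \<epsilon> c m u)"

text \<open>The message \<open>m\<^sub>b\<close> of block \<open>b \<ge> 1\<close>, where \<open>us b\<close> is the source block \<open>b\<close>. The value at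
  \<open>b = 0\<close> plays no role.\<close>

fun message ::
    "('u::finite, 'x::finite, 'w::finite, 'y, 'v) letters pmf \<Rightarrow> real \<Rightarrow> nat \<Rightarrow> real \<Rightarrow>
     ('u, 'x, 'w) rule \<Rightarrow> ('x, 'w) codebook \<Rightarrow> (nat \<Rightarrow> nat \<Rightarrow> 'u) \<Rightarrow> nat \<Rightarrow> nat" where
  "message J R n \<epsilon> rule c us 0 = 1"
| "message J R n \<epsilon> rule c us (Suc 0) = 1"
| "message J R n \<epsilon> rule c us (Suc (Suc b)) =
     encode J R n \<epsilon> rule c (message J R n \<epsilon> rule c us (Suc b)) (us (Suc b))"


section \<open>Transmission\<close>

text \<open>Channel outputs at times \<open>1, \<dots>, n\<close> for input \<open>x\<close> and starting state \<open>s\<close>, which is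
  stored at time 0.\<close>

primrec transmit ::
    "('x \<Rightarrow> 'y \<Rightarrow> 'y pmf) \<Rightarrow> (nat \<Rightarrow> 'x) \<Rightarrow> 'y \<Rightarrow> nat \<Rightarrow> (nat \<Rightarrow> 'y) pmf" where
  "transmit Ch x s 0 = return_pmf (\<lambda>_. s)"
| "transmit Ch x s (Suc t) =
     do { y \<leftarrow> transmit Ch x s t; y' \<leftarrow> Ch (x (Suc t)) (y t); return_pmf (y(Suc t := y')) }"

text \<open>Outputs \<open>ys b t\<close> of blocks \<open>1, \<dots>, B\<close> when block \<open>b\<close> has input \<open>xs b\<close>. The fictitious
  block 0 is constantly equal to the starting state \<open>s\<close> of the whole transmission.\<close>

primrec transmit_blocks ::
    "('x \<Rightarrow> 'y \<Rightarrow> 'y pmf) \<Rightarrow> nat \<Rightarrow> 'y \<Rightarrow> (nat \<Rightarrow> nat \<Rightarrow> 'x) \<Rightarrow> nat \<Rightarrow> (nat \<Rightarrow> nat \<Rightarrow> 'y) pmf" where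
  "transmit_blocks Ch n s xs 0 = return_pmf (\<lambda>_ _. s)"
| "transmit_blocks Ch n s xs (Suc b) =
     do { ys \<leftarrow> transmit_blocks Ch n s xs b;
          y \<leftarrow> transmit Ch (xs (Suc b)) (ys b n) n;
          return_pmf (ys(Suc b := y)) }"

text \<open>For a given codebook, the joint distribution of the source blocks, the messages and the
  channel output blocks.\<close>

definition transmission_pmf ::
    "'u pmf \<Rightarrow> ('x \<Rightarrow> 'y \<Rightarrow> 'y pmf) \<Rightarrow>
     ('u::finite, 'x::finite, 'w::finite, 'y, 'v) letters pmf \<Rightarrow> real \<Rightarrow> nat \<Rightarrow> nat \<Rightarrow> real \<Rightarrow>
     ('u, 'x, 'w) rule \<Rightarrow> 'y \<Rightarrow> ('x, 'w) codebook \<Rightarrow>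
     ((nat \<Rightarrow> nat \<Rightarrow> 'u) \<times> (nat \<Rightarrow> nat) \<times> (nat \<Rightarrow> nat \<Rightarrow> 'y)) pmf" where
  "transmission_pmf PU Ch J R B n \<epsilon> rule s c =
     do { us \<leftarrow> Pi_pmf {1..B} undefined (\<lambda>_. Pi_pmf {1..n} undefined (\<lambda>_. PU));
          let ms = message J R n \<epsilon> rule c us;
          ys \<leftarrow> transmit_blocks Ch n s (\<lambda>b. cb_X c (ms b)) B;
          return_pmf (us, ms, ys) }"

definition event_A ::
    "('u, 'x::finite, 'w, 'y::finite, 'v) letters pmf \<Rightarrow> nat \<Rightarrow> real \<Rightarrow> ('x, 'w) codebook \<Rightarrow>
     (nat \<Rightarrow> nat \<Rightarrow> 'y) \<Rightarrow> nat \<Rightarrow> nat \<Rightarrow> bool" where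
  "event_A J n \<epsilon> c ys b m' \<longleftrightarrow> typical_Y'XY J n \<epsilon> (cb_X c m') (ys b)"

definition event_B ::
    "('u, 'x::finite, 'w::finite, 'y::finite, 'v) letters pmf \<Rightarrow> nat \<Rightarrow> real \<Rightarrow>
     ('x, 'w) codebook \<Rightarrow> (nat \<Rightarrow> nat) \<Rightarrow> (nat \<Rightarrow> nat \<Rightarrow> 'y) \<Rightarrow> nat \<Rightarrow> nat \<Rightarrow> bool" where
  "event_B J n \<epsilon> c ms ys b m' \<longleftrightarrow>
     typical_WY'XY J n \<epsilon> (cb_W c (ms b) m') (cb_X c (ms b)) (ys b)"

definition confusion ::
    "('u, 'x::finite, 'w::finite, 'y::finite, 'v) letters pmf \<Rightarrow> real \<Rightarrow> nat \<Rightarrow> real \<Rightarrow>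
     ('x, 'w) codebook \<Rightarrow> (nat \<Rightarrow> nat) \<Rightarrow> (nat \<Rightarrow> nat \<Rightarrow> 'y) \<Rightarrow> nat \<Rightarrow> bool" where
  "confusion J R n \<epsilon> c ms ys b \<longleftrightarrow>
     (\<exists>m'\<in>messages R n. m' \<noteq> ms b \<and> event_A J n \<epsilon> c ys b m' \<and> event_B J n \<epsilon> c ms ys (b - 1) m')"

end

theory Submission
  imports Defs
begin

text \<open>
  The event \<open>A\<^sub>b\<close> alone suffices. Let \<open>x\<^sup>n\<close> be an arbitrary fixed sequence. If the channel is fed
  with i.i.d. inputs of distribution \<open>P\<^sub>X\<close>, its output is a Markov chain with the averaged kernel
  \<open>K\<close>. The product along \<open>x\<^sup>n\<close> of the likelihood ratios of the channel against \<open>K\<close> has expectation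
  at most 1, but on outputs jointly typical with \<open>x\<^sup>n\<close> it is at least \<open>2\<close> to the power
  \<open>n (I(X;Y|Y') - \<delta>/2)\<close>. By Markov's inequality joint typicality is exponentially unlikely, and a
  union bound over the \<open>2\<close> to the power \<open>n R\<close> messages still tends to 0.

  The union bound has to cope with the dependence of \<open>m\<^sub>b\<close> on the codebook. The messages form a
  walk whose next index depends only on the row of the current one. When \<open>m\<^sub>b\<close> was visited for the
  first time, its row was independent of all other rows, so the bound applies with any other
  codeword as the fixed sequence. There are at most \<open>b\<close> times for this first visit. Conditionally on
  \<open>m\<^bsub>b-1\<^esub> = m\<close> the same argument applies to the walk of one step that starts in \<open>m\<close>, because the
  source block \<open>b - 1\<close> is independent of the past.
\<close>

section \<open>Conditional mutual information as a finite sum\<close>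

lemma distributed_pmf:
  "distributed (measure_pmf p) (count_space UNIV) X (\<lambda>x. ennreal (pmf (map_pmf X p) x))"
proof -
  have "distr (measure_pmf p) (count_space UNIV) X = measure_pmf (map_pmf X p)"
    by (simp add: map_pmf_rep_eq)
  also have "\<dots> = density (count_space UNIV) (\<lambda>x. ennreal (pmf (map_pmf X p) x))"
    by (rule measure_pmf_eq_density)
  finally show ?thesis by (simp add: distributed_def)
qed

text \<open>The densities with respect to counting measure are pmfs, and on finite types the
  defining integral is a sum. The inner quotient is the law of \<open>Y\<close> given
  \<open>Z\<close>.\<close>

lemma cond_info_eq_sum:
  fixes X :: "'a \<Rightarrow> 'b::finite" and Y :: "'a \<Rightarrow> 'c::finite" and Z :: "'a \<Rightarrow> 'd::finite"
  shows "cond_info p X Y Z = (\<Sum>(x, y, z)\<in>UNIV. pmf (map_pmf (\<lambda>a. (X a, Y a, Z a)) p) (x, y, z) *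
    log 2 (pmf (map_pmf (\<lambda>a. (X a, Y a, Z a)) p) (x, y, z) /
      (pmf (map_pmf (\<lambda>a. (X a, Z a)) p) (x, z) *
       (pmf (map_pmf (\<lambda>a. (Y a, Z a)) p) (y, z) / pmf (map_pmf Z p) z))))"
proof -
  interpret information_space "measure_pmf p" 2
    by unfold_locales simp
  note [simp] = pair_measure_count_space
  show ?thesis
    unfolding cond_info_def
    by (subst conditional_mutual_information_generic_eq[OF _ _ _ distributed_pmf _ distributed_pmf])
       (use distributed_pmf[of p] in \<open>auto intro!: sigma_finite_measure_count_space_finite
          integrable_count_space simp: lebesgue_integral_count_space_finite\<close>)
qed

lemma pmf_bind_Pair:
  "pmf (bind_pmf p (\<lambda>x. map_pmf (Pair x) (q x))) (a, b) = pmf p a * pmf (q a) b"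
proof -
  have "pmf (map_pmf (Pair x) (q x)) (a, b) = indicator {a} x * pmf (q a) b" for x
  proof (cases "x = a")
    case True
    then show ?thesis by (simp add: pmf_map_inj' inj_on_def)
  next
    case False
    then have "(a, b) \<notin> Pair x ` set_pmf (q x)" by auto
    with False show ?thesis by (simp add: pmf_map_outside)
  qed
  then show ?thesis
    by (simp add: pmf_bind measure_pmf_single)
qed

text \<open>\<open>X\<close> and \<open>Y'\<close> are independent, so the state may be drawn first;
  the chain rule \<open>pmf_bind_Pair\<close> applies to this nested shape.\<close>

lemma map_joint_pmf_Y'XY:
  "map_pmf (\<lambda>z. (pr_Y' z, pr_X z, pr_Y z)) (joint_pmf PU PX PW \<pi> Ch PV) =
     bind_pmf \<pi> (\<lambda>y'. map_pmf (Pair y') (bind_pmf PX (\<lambda>x. map_pmf (Pair x) (Ch x y'))))"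
proof -
  have "map_pmf (\<lambda>z. (pr_Y' z, pr_X z, pr_Y z)) (joint_pmf PU PX PW \<pi> Ch PV) =
     bind_pmf PX (\<lambda>x. bind_pmf \<pi> (\<lambda>y'. bind_pmf (Ch x y') (\<lambda>y. return_pmf (y', x, y))))"
    by (simp add: joint_pmf_def map_bind_pmf pr_Y'_def pr_X_def pr_Y_def)
  also have "\<dots> = bind_pmf \<pi> (\<lambda>y'. bind_pmf PX (\<lambda>x. bind_pmf (Ch x y') (\<lambda>y. return_pmf (y', x, y))))"
    by (rule bind_commute_pmf)
  finally show ?thesis
    by (simp add: map_bind_pmf map_pmf_def bind_assoc_pmf bind_return_pmf)
qed

lemma pmf_joint_pmf_Y'XY:
  "pmf (map_pmf (\<lambda>z. (pr_Y' z, pr_X z, pr_Y z)) (joint_pmf PU PX PW \<pi> Ch PV)) (y', x, y) =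
     pmf \<pi> y' * (pmf PX x * pmf (Ch x y') y)"
  unfolding map_joint_pmf_Y'XY by (simp add: pmf_bind_Pair)

text \<open>By independence of \<open>X\<close> and \<open>Y'\<close>, the factors from
  \<open>\<pi>\<close> and \<open>PX\<close> cancel inside the logarithm, which leaves the
  likelihood ratio of the channel against its average over inputs. Where these factors vanish, so
  does the weight.\<close>

lemma cond_info_joint_pmf:
  fixes PU :: "'u pmf" and PX :: "'x::finite pmf" and PW :: "'u \<Rightarrow> 'x \<Rightarrow> 'w pmf"
    and \<pi> :: "'y::finite pmf" and Ch :: "'x \<Rightarrow> 'y \<Rightarrow> 'y pmf"
    and PV :: "'y \<Rightarrow> 'x \<Rightarrow> 'w \<Rightarrow> 'v pmf"
  defines "J \<equiv> joint_pmf PU PX PW \<pi> Ch PV"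
  shows "cond_info J pr_X pr_Y pr_Y' =
    (\<Sum>(y', x, y)\<in>UNIV. pmf (map_pmf (\<lambda>z. (pr_Y' z, pr_X z, pr_Y z)) J) (y', x, y) *
       log 2 (pmf (Ch x y') y / pmf (mean_kernel Ch PX y') y))"
proof -
  let ?q = "map_pmf (\<lambda>z. (pr_Y' z, pr_X z, pr_Y z)) J"
  have q: "?q = bind_pmf \<pi> (\<lambda>y'. map_pmf (Pair y') (bind_pmf PX (\<lambda>x. map_pmf (Pair x) (Ch x y'))))"
    unfolding J_def by (rule map_joint_pmf_Y'XY)
  have xyz: "pmf (map_pmf (\<lambda>a. (pr_X a, pr_Y a, pr_Y' a)) J) (x, y, y') = pmf ?q (y', x, y)"
    for x y y'
  proof -
    have "map_pmf (\<lambda>a. (pr_X a, pr_Y a, pr_Y' a)) J = map_pmf (\<lambda>(y', x, y). (x, y, y')) ?q"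
      by (simp add: pmf.map_comp o_def)
    also have "pmf \<dots> ((\<lambda>(y', x, y). (x, y, y')) (y', x, y)) = pmf ?q (y', x, y)"
      by (rule pmf_map_inj') (auto simp: inj_def)
    finally show ?thesis by simp
  qed
  have z: "map_pmf pr_Y' J = \<pi>"
  proof -
    have "map_pmf pr_Y' J = map_pmf fst ?q" by (simp add: pmf.map_comp o_def)
    also have "\<dots> = \<pi>" unfolding q by (simp add: map_bind_pmf pmf.map_comp o_def map_pmf_const bind_return_pmf')
    finally show ?thesis .
  qed
  have xz: "pmf (map_pmf (\<lambda>a. (pr_X a, pr_Y' a)) J) (x, y') = pmf \<pi> y' * pmf PX x" for x y'
  proof -
    have "map_pmf (\<lambda>a. (pr_X a, pr_Y' a)) J = map_pmf prod.swap (map_pmf (\<lambda>(y', x, y). (y', x)) ?q)"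
      by (simp add: pmf.map_comp o_def)
    also have "map_pmf (\<lambda>(y', x, y). (y', x)) ?q = bind_pmf \<pi> (\<lambda>y'. map_pmf (Pair y') PX)"
      unfolding q by (simp add: map_bind_pmf pmf.map_comp o_def map_pmf_const map_pmf_def[symmetric])
    also have "pmf (map_pmf prod.swap (bind_pmf \<pi> (\<lambda>y'. map_pmf (Pair y') PX))) (prod.swap (y', x))
       = pmf \<pi> y' * pmf PX x"
      by (subst pmf_map_inj') (auto simp: pmf_bind_Pair)
    finally show ?thesis by simp
  qed
  have yz: "pmf (map_pmf (\<lambda>a. (pr_Y a, pr_Y' a)) J) (y, y') = pmf \<pi> y' * pmf (mean_kernel Ch PX y') y" for y y'
  proof -
    have "map_pmf (\<lambda>a. (pr_Y a, pr_Y' a)) J = map_pmf prod.swap (map_pmf (\<lambda>(y', x, y). (y', y)) ?q)"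
      by (simp add: pmf.map_comp o_def)
    also have "map_pmf (\<lambda>(y', x, y). (y', y)) ?q = bind_pmf \<pi> (\<lambda>y'. map_pmf (Pair y') (mean_kernel Ch PX y'))"
      unfolding q mean_kernel_def by (simp add: map_bind_pmf pmf.map_comp o_def)
    also have "pmf (map_pmf prod.swap (bind_pmf \<pi> (\<lambda>y'. map_pmf (Pair y') (mean_kernel Ch PX y')))) (prod.swap (y', y))
       = pmf \<pi> y' * pmf (mean_kernel Ch PX y') y"
      by (subst pmf_map_inj') (auto simp: pmf_bind_Pair)
    finally show ?thesis by simp
  qed
  have "cond_info J pr_X pr_Y pr_Y' =
    (\<Sum>(x, y, y')\<in>UNIV. pmf ?q (y', x, y) * log 2 (pmf (Ch x y') y / pmf (mean_kernel Ch PX y') y))"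
    unfolding cond_info_eq_sum xyz xz yz z
    by (intro sum.cong refl) (auto simp: J_def pmf_joint_pmf_Y'XY)
  also have "\<dots> = (\<Sum>(y', x, y)\<in>UNIV. pmf ?q (y', x, y) *
       log 2 (pmf (Ch x y') y / pmf (mean_kernel Ch PX y') y))"
    by (rule sum.reindex_bij_witness[of _ "\<lambda>(y', x, y). (x, y, y')" "\<lambda>(x, y, y'). (y', x, y)"]) auto
  finally show ?thesis .
qed

section \<open>Joint typicality with a fixed sequence, by change of measure\<close>

lemma transmit_cong:
  "(\<And>t. t \<in> {1..n} \<Longrightarrow> x t = x' t) \<Longrightarrow> transmit Ch x s n = transmit Ch x' s n"
proof (induction n)
  case (Suc n)
  have "transmit Ch x s n = transmit Ch x' s n"
    by (rule Suc.IH) (simp add: Suc.prems)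
  moreover have "x (Suc n) = x' (Suc n)" by (rule Suc.prems) simp
  ultimately show ?case by simp
qed simp

text \<open>The newest input is independent of all earlier inputs and outputs, so averaging it last
  gives one step of the mean kernel. The resulting Markov chain is again a \<open>transmit\<close>,
  with dummy inputs of type unit.\<close>

lemma bind_Pi_pmf_transmit:
  "bind_pmf (Pi_pmf {1..n} dflt (\<lambda>_. PX)) (\<lambda>x. transmit Ch x s n) =
     transmit (\<lambda>_. mean_kernel Ch PX) (\<lambda>_. ()) s n"
proof (induction n)
  case (Suc n)
  have "bind_pmf (Pi_pmf {1..Suc n} dflt (\<lambda>_. PX)) (\<lambda>x. transmit Ch x s (Suc n)) =
     bind_pmf PX (\<lambda>a. bind_pmf (Pi_pmf {1..n} dflt (\<lambda>_. PX)) (\<lambda>x.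
       bind_pmf (transmit Ch (x(Suc n := a)) s n) (\<lambda>y.
       bind_pmf (Ch a (y n)) (\<lambda>y'. return_pmf (y(Suc n := y'))))))"
    by (simp add: atLeastAtMostSuc_conv Pi_pmf_insert' bind_assoc_pmf bind_return_pmf)
  \<comment> \<open>The first \<open>n\<close> outputs do not read the input at time
    \<open>Suc n\<close>.\<close>
  also have "\<dots> = bind_pmf PX (\<lambda>a. bind_pmf (Pi_pmf {1..n} dflt (\<lambda>_. PX)) (\<lambda>x.
       bind_pmf (transmit Ch x s n) (\<lambda>y.
       bind_pmf (Ch a (y n)) (\<lambda>y'. return_pmf (y(Suc n := y'))))))"
    by (intro bind_pmf_cong refl arg_cong2[where f = bind_pmf] transmit_cong) auto
  also have "\<dots> = bind_pmf PX (\<lambda>a. bind_pmf (transmit (\<lambda>_. mean_kernel Ch PX) (\<lambda>_. ()) s n) (\<lambda>y.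
       bind_pmf (Ch a (y n)) (\<lambda>y'. return_pmf (y(Suc n := y')))))"
    by (simp add: bind_assoc_pmf flip: Suc.IH)
  also have "\<dots> = bind_pmf (transmit (\<lambda>_. mean_kernel Ch PX) (\<lambda>_. ()) s n) (\<lambda>y.
       bind_pmf PX (\<lambda>a. bind_pmf (Ch a (y n)) (\<lambda>y'. return_pmf (y(Suc n := y')))))"
    by (rule bind_commute_pmf)
  also have "\<dots> = transmit (\<lambda>_. mean_kernel Ch PX) (\<lambda>_. ()) s (Suc n)"
    unfolding transmit.simps(2)
    by (intro bind_pmf_cong refl) (simp add: mean_kernel_def bind_assoc_pmf)
  finally show ?case .
qed (simp add: bind_return_pmf)

text \<open>Given the past, each new factor has mean at most 1: the products form a
  supermartingale.\<close>

lemma nn_integral_transmit_prod_le: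
  fixes w :: "'y \<times> 'x \<times> 'y \<Rightarrow> real" and K :: "'y \<Rightarrow> 'y pmf"
  assumes nonneg: "\<And>a. w a \<ge> 0"
    and w: "\<And>y' x. (\<integral>\<^sup>+ y. ennreal (w (y', x, y)) \<partial>K y') \<le> 1"
  shows "(\<integral>\<^sup>+ y. ennreal (\<Prod>t\<in>{1..n}. w (y (t - 1), x t, y t)) \<partial>transmit (\<lambda>_. K) z s n) \<le> 1"
proof (induction n)
  case (Suc n)
  have split: "(\<Prod>t\<in>{1..Suc n}. w ((y(Suc n := y')) (t - 1), x t, (y(Suc n := y')) t)) =
      (\<Prod>t\<in>{1..n}. w (y (t - 1), x t, y t)) * w (y n, x (Suc n), y')" for y y'
  proof -
    have "(\<Prod>t\<in>{1..n}. w ((y(Suc n := y')) (t - 1), x t, (y(Suc n := y')) t)) =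
        (\<Prod>t\<in>{1..n}. w (y (t - 1), x t, y t))"
      by (intro prod.cong refl) auto
    then show ?thesis by simp
  qed
  have "(\<integral>\<^sup>+ y. ennreal (\<Prod>t\<in>{1..Suc n}. w (y (t - 1), x t, y t)) \<partial>transmit (\<lambda>_. K) z s (Suc n)) =
      (\<integral>\<^sup>+ y. \<integral>\<^sup>+ y'. ennreal ((\<Prod>t\<in>{1..n}. w (y (t - 1), x t, y t)) * w (y n, x (Suc n), y'))
        \<partial>K (y n) \<partial>transmit (\<lambda>_. K) z s n)"
    unfolding split[symmetric] by (simp only: transmit.simps nn_integral_bind_pmf nn_integral_return)
      simp
  also have "\<dots> =
      (\<integral>\<^sup>+ y. ennreal (\<Prod>t\<in>{1..n}. w (y (t - 1), x t, y t)) *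
        (\<integral>\<^sup>+ y'. ennreal (w (y n, x (Suc n), y')) \<partial>K (y n)) \<partial>transmit (\<lambda>_. K) z s n)"
    by (simp add: ennreal_mult prod_nonneg nonneg nn_integral_cmult)
  also have "\<dots> \<le> (\<integral>\<^sup>+ y. ennreal (\<Prod>t\<in>{1..n}. w (y (t - 1), x t, y t)) * 1 \<partial>transmit (\<lambda>_. K) z s n)"
    by (intro nn_integral_mono mult_left_mono w) auto
  also have "\<dots> \<le> 1" using Suc.IH by simp
  finally show ?case .
qed (simp)

text \<open>Grouping times by letter, the logarithm of the product is \<open>n\<close> times an
  empirical mean. An l1 error of \<epsilon> in the distribution moves the mean of a function bounded
  by \<open>L\<close> by at most \<epsilon> times \<open>L\<close>.\<close>

lemma typical_imp_prod_ge:
  assumes typical: "typical n \<epsilon> P f" and pos: "\<And>a. w a > 0" and L: "\<And>a. \<bar>log 2 (w a)\<bar> \<le> L"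
  shows "2 powr (real n * ((\<Sum>a\<in>UNIV. pmf P a * log 2 (w a)) - \<epsilon> * L)) \<le> (\<Prod>t\<in>{1..n}. w (f t))"
proof -
  have emp: "(\<Sum>t\<in>{1..n}. log 2 (w (f t))) = real n * (\<Sum>a\<in>UNIV. empirical n f a * log 2 (w a))"
    by (subst sum_fun_comp[where R = UNIV]) (auto simp: empirical_def sum_distrib_left intro!: sum.cong)
  have "(\<Sum>a\<in>UNIV. pmf P a * log 2 (w a)) - (\<Sum>a\<in>UNIV. empirical n f a * log 2 (w a)) =
      (\<Sum>a\<in>UNIV. (pmf P a - empirical n f a) * log 2 (w a))"
    by (simp add: sum_subtractf left_diff_distrib)
  also have "\<dots> \<le> (\<Sum>a\<in>UNIV. \<bar>empirical n f a - pmf P a\<bar> * L)"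
  proof (rule sum_mono)
    fix a
    have "(pmf P a - empirical n f a) * log 2 (w a) \<le> \<bar>pmf P a - empirical n f a\<bar> * \<bar>log 2 (w a)\<bar>"
      by (metis abs_ge_self abs_mult)
    also have "\<dots> \<le> \<bar>empirical n f a - pmf P a\<bar> * L"
      by (subst abs_minus_commute) (intro mult_left_mono L, simp)
    finally show "(pmf P a - empirical n f a) * log 2 (w a) \<le> \<bar>empirical n f a - pmf P a\<bar> * L" .
  qed
  also have "\<dots> \<le> \<epsilon> * L"
  proof -
    have "L \<ge> 0" using L[of undefined] by linarith
    with typical show ?thesis
      unfolding typical_def sum_distrib_right[symmetric] by (intro mult_right_mono)
  qed
  finally have "(\<Sum>a\<in>UNIV. pmf P a * log 2 (w a)) - \<epsilon> * L \<le> (\<Sum>a\<in>UNIV. empirical n f a * log 2 (w a))"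
    by simp
  then have "2 powr (real n * ((\<Sum>a\<in>UNIV. pmf P a * log 2 (w a)) - \<epsilon> * L)) \<le>
      2 powr (\<Sum>t\<in>{1..n}. log 2 (w (f t)))"
    unfolding emp by (intro powr_mono mult_left_mono) auto
  also have "\<dots> = (\<Prod>t\<in>{1..n}. w (f t))"
    by (simp add: powr_sum pos)
  finally show ?thesis .
qed

text \<open>The loss \<delta> in the exponent is spent in two halves: one on making the likelihood
  ratio positive, one on the slack of typicality. Uniformity in \<open>x\<close> and
  \<open>s\<close> lets the bound be used conditionally on other codewords and on the past.\<close>

lemma ex_typicality_bound:
  fixes PU :: "'u pmf" and PX :: "'x::finite pmf" and PW :: "'u \<Rightarrow> 'x \<Rightarrow> 'w pmf"
    and \<pi> :: "'y::finite pmf" and Ch :: "'x \<Rightarrow> 'y \<Rightarrow> 'y pmf"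
    and PV :: "'y \<Rightarrow> 'x \<Rightarrow> 'w \<Rightarrow> 'v pmf" and \<delta> :: real
  defines "J \<equiv> joint_pmf PU PX PW \<pi> Ch PV"
  assumes "\<delta> > 0"
  shows "\<exists>\<epsilon>\<^sub>0>0. \<forall>\<epsilon>\<le>\<epsilon>\<^sub>0. \<forall>n s x.
    emeasure (bind_pmf (Pi_pmf {1..n} undefined (\<lambda>_. PX)) (\<lambda>x'. transmit Ch x' s n))
      {y. typical_Y'XY J n \<epsilon> x y} \<le> ennreal (2 powr - (real n * (cond_info J pr_X pr_Y pr_Y' - \<delta>)))"
proof -
  define K where "K = mean_kernel Ch PX"
  define P where "P = map_pmf (\<lambda>z. (pr_Y' z, pr_X z, pr_Y z)) J"
  \<comment> \<open>Chosen so that the factor \<open>1 - \<theta>\<close> costs exactly \<delta>/2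
    in the base-2 logarithm.\<close>
  define \<theta> :: real where "\<theta> = 1 - 2 powr (- \<delta> / 2)"
  have \<theta>: "0 < \<theta>" "\<theta> < 1"
    using powr_less_mono[of "- \<delta> / 2" 0 2] \<open>\<delta> > 0\<close> by (auto simp: \<theta>_def)
  \<comment> \<open>The likelihood ratio of \<open>Ch\<close> against \<open>K\<close>, with \<open>Ch\<close> mixed with \<open>K\<close> to make it positive.\<close>
  define w where "w = (\<lambda>(y', x, y). if pmf (K y') y = 0 then 1
    else (1 - \<theta>) * (pmf (Ch x y') y / pmf (K y') y) + \<theta>)"
  \<comment> \<open>The summand 1 keeps \<open>L\<close> positive, since \<delta> is divided by it
    below.\<close>
  define L where "L = 1 + (\<Sum>a\<in>UNIV. \<bar>log 2 (w a)\<bar>)"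
  have pos: "w a > 0" for a
    using \<theta> by (auto simp: w_def split: prod.splits intro!: add_nonneg_pos)
  have "0 \<le> (\<Sum>a\<in>UNIV. \<bar>log 2 (w a)\<bar>)" by (intro sum_nonneg) auto
  then have "L > 0" unfolding L_def by linarith
  have L: "\<bar>log 2 (w a)\<bar> \<le> L" for a
    using member_le_sum[of a UNIV "\<lambda>a. \<bar>log 2 (w a)\<bar>"] by (simp add: L_def)
  have int: "(\<integral>\<^sup>+ y. ennreal (w (y', x, y)) \<partial>K y') \<le> 1" for y' x
  proof -
    have "(\<integral>\<^sup>+ y. ennreal (w (y', x, y)) \<partial>K y') = (\<Sum>y\<in>UNIV. ennreal (w (y', x, y)) * ennreal (pmf (K y') y))"
      by (rule nn_integral_measure_pmf_support) auto
    also have "\<dots> = ennreal (\<Sum>y\<in>UNIV. w (y', x, y) * pmf (K y') y)"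
      using less_imp_le[OF pos] by (simp flip: ennreal_mult)
    \<comment> \<open>Only an inequality: if \<open>PX\<close> gives \<open>x\<close> no mass,
      \<open>Ch x y'\<close> may charge outputs outside the support of \<open>K y'\<close>.\<close>
    also have "\<dots> \<le> ennreal (\<Sum>y\<in>UNIV. (1 - \<theta>) * pmf (Ch x y') y + \<theta> * pmf (K y') y)"
      using \<theta> by (intro ennreal_leI sum_mono) (auto simp: w_def field_simps intro: mult_left_le_one_le)
    also have "\<dots> = 1"
      by (simp add: sum.distrib flip: sum_distrib_left) (simp add: sum_pmf_eq_1)
    finally show ?thesis .
  qed
  \<comment> \<open>On the support of \<open>P\<close> the default value 1 of \<open>w\<close> is
    never taken.\<close>
  have supp: "pmf (K y') y > 0 \<and> pmf (Ch x y') y > 0" if "pmf P (y', x, y) > 0" for y' x y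
  proof -
    have "x \<in> set_pmf PX" "y \<in> set_pmf (Ch x y')"
      using that unfolding P_def J_def pmf_joint_pmf_Y'XY
      by (auto simp: zero_less_mult_iff set_pmf_iff)
    then show ?thesis
      by (auto simp: K_def mean_kernel_def pmf_positive_iff)
  qed
  have info: "cond_info J pr_X pr_Y pr_Y' - \<delta> / 2 \<le> (\<Sum>a\<in>UNIV. pmf P a * log 2 (w a))"
  proof -
    have "cond_info J pr_X pr_Y pr_Y' - \<delta> / 2 =
      (\<Sum>(y', x, y)\<in>UNIV. pmf P (y', x, y) * log 2 (pmf (Ch x y') y / pmf (K y') y))
        + (\<Sum>a\<in>UNIV. pmf P a) * log 2 (1 - \<theta>)"
      unfolding J_def cond_info_joint_pmf P_def K_def
      by (simp add: sum_pmf_eq_1 \<theta>_def)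
    also have "\<dots> = (\<Sum>(y', x, y)\<in>UNIV. pmf P (y', x, y) *
        (log 2 (1 - \<theta>) + log 2 (pmf (Ch x y') y / pmf (K y') y)))"
      by (simp add: sum_distrib_right distrib_left split_def flip: sum.distrib) (simp add: add.commute)
    also have "\<dots> \<le> (\<Sum>a\<in>UNIV. pmf P a * log 2 (w a))"
    proof (rule sum_mono, clarsimp split: prod.splits)
      fix y' x y
      show "pmf P (y', x, y) * (log 2 (1 - \<theta>) + log 2 (pmf (Ch x y') y / pmf (K y') y))
        \<le> pmf P (y', x, y) * log 2 (w (y', x, y))"
      proof (cases "pmf P (y', x, y) > 0")
        case True
        with supp have *: "pmf (K y') y > 0" "pmf (Ch x y') y > 0" by auto
        then have "log 2 (1 - \<theta>) + log 2 (pmf (Ch x y') y / pmf (K y') y) =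
            log 2 ((1 - \<theta>) * (pmf (Ch x y') y / pmf (K y') y))"
          using \<theta> by (subst log_mult) auto
        also have "\<dots> \<le> log 2 (w (y', x, y))"
          using * \<theta> by (intro log_mono) (auto simp: w_def)
        finally show ?thesis by (intro mult_left_mono) auto
      qed (simp add: not_less pmf_nonneg antisym)
    qed
    finally show ?thesis .
  qed
  show ?thesis
  proof (intro exI[of _ "\<delta> / (2 * L)"] conjI allI impI)
    show "\<delta> / (2 * L) > 0" using \<open>\<delta> > 0\<close> \<open>L > 0\<close> by simp
  next
    fix \<epsilon> n s and x :: "nat \<Rightarrow> 'x"
    assume "\<epsilon> \<le> \<delta> / (2 * L)"
    then have \<epsilon>: "\<epsilon> * L \<le> \<delta> / 2" using \<open>L > 0\<close> by (simp add: field_simps)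
    let ?T = "transmit (\<lambda>_. K) (\<lambda>_. ()) s n"
    let ?I = "cond_info J pr_X pr_Y pr_Y' - \<delta>"
    let ?c = "2 powr - (real n * ?I)"
    have ge: "2 powr (real n * ?I) \<le> (\<Prod>t\<in>{1..n}. w (y (t - 1), x t, y t))"
      if "typical_Y'XY J n \<epsilon> x y" for y
    proof -
      have "2 powr (real n * ?I) \<le> 2 powr (real n * ((\<Sum>a\<in>UNIV. pmf P a * log 2 (w a)) - \<epsilon> * L))"
        using info \<epsilon> by (intro powr_mono mult_left_mono) auto
      also have "\<dots> \<le> (\<Prod>t\<in>{1..n}. w (y (t - 1), x t, y t))"
        using that unfolding typical_Y'XY_def P_def[symmetric] by (rule typical_imp_prod_ge[OF _ pos L])
      finally show ?thesis .
    qed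
    have "emeasure ?T {y. typical_Y'XY J n \<epsilon> x y} = (\<integral>\<^sup>+ y. indicator {y. typical_Y'XY J n \<epsilon> x y} y \<partial>?T)"
      by simp
    \<comment> \<open>Markov's inequality, applied pointwise to the indicator.\<close>
    also have "\<dots> \<le> (\<integral>\<^sup>+ y. ennreal ?c * ennreal (\<Prod>t\<in>{1..n}. w (y (t - 1), x t, y t)) \<partial>?T)"
    proof (intro nn_integral_mono)
      fix y
      show "indicator {y. typical_Y'XY J n \<epsilon> x y} y \<le>
          ennreal ?c * ennreal (\<Prod>t\<in>{1..n}. w (y (t - 1), x t, y t))"
      proof (cases "typical_Y'XY J n \<epsilon> x y")
        case True
        have "1 = ?c * 2 powr (real n * ?I)" by (simp flip: powr_add)
        also have "\<dots> \<le> ?c * (\<Prod>t\<in>{1..n}. w (y (t - 1), x t, y t))"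
          by (intro mult_left_mono ge True) auto
        finally show ?thesis
          using True less_imp_le[OF pos] by (simp flip: ennreal_mult add: prod_nonneg)
      qed simp
    qed
    also have "\<dots> = ennreal ?c * (\<integral>\<^sup>+ y. ennreal (\<Prod>t\<in>{1..n}. w (y (t - 1), x t, y t)) \<partial>?T)"
      by (rule nn_integral_cmult) simp
    also have "\<dots> \<le> ennreal ?c * 1"
      by (intro mult_left_mono nn_integral_transmit_prod_le int less_imp_le pos) auto
    finally show "emeasure (bind_pmf (Pi_pmf {1..n} undefined (\<lambda>_. PX)) (\<lambda>x'. transmit Ch x' s n))
      {y. typical_Y'XY J n \<epsilon> x y} \<le> ennreal ?c"
      by (simp only: bind_Pi_pmf_transmit K_def mult_1_right)
  qed
qed

section \<open>Walks on independent rows\<close>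

text \<open>Independence in the form used below, both for codebook rows and for source blocks: one
  coordinate may be replaced by a fresh draw.\<close>

lemma Pi_pmf_resample:
  assumes "finite A" "a \<in> A"
  shows "bind_pmf (Pi_pmf A dflt p) (\<lambda>f. map_pmf (\<lambda>r. f(a := r)) (p a)) = Pi_pmf A dflt p"
proof -
  have *: "Pi_pmf A dflt p = bind_pmf (p a) (\<lambda>r. map_pmf (\<lambda>f. f(a := r)) (Pi_pmf (A - {a}) dflt p))"
    using assms Pi_pmf_insert'[of "A - {a}" a dflt p] by (simp add: insert_absorb map_pmf_def)
  have "bind_pmf (Pi_pmf A dflt p) (\<lambda>f. map_pmf (\<lambda>r. f(a := r)) (p a)) =
      bind_pmf (Pi_pmf (A - {a}) dflt p) (\<lambda>f. map_pmf (\<lambda>r. f(a := r)) (p a))"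
  proof -
    have "fun_upd (f(a := x)) a = fun_upd f a" for f :: "'a \<Rightarrow> 'b" and x by auto
    then show ?thesis unfolding * by (simp add: bind_assoc_pmf bind_map_pmf)
  qed
  also have "\<dots> = Pi_pmf A dflt p"
    unfolding * map_pmf_def by (rule bind_commute_pmf)
  finally show ?thesis .
qed

text \<open>Abstract form of the message process: step \<open>j\<close> depends on the codebook only
  through the row of the current index.\<close>

primrec walk :: "(nat \<Rightarrow> 'i \<Rightarrow> 'r \<Rightarrow> 'i) \<Rightarrow> 'i \<Rightarrow> ('i \<Rightarrow> 'r) \<Rightarrow> nat \<Rightarrow> 'i" where
  "walk F i c 0 = i"
| "walk F i c (Suc j) = F j (walk F i c j) (c (walk F i c j))"

definition first_visit :: "(nat \<Rightarrow> 'i \<Rightarrow> 'r \<Rightarrow> 'i) \<Rightarrow> 'i \<Rightarrow> ('i \<Rightarrow> 'r) \<Rightarrow> nat \<Rightarrow> 'i \<Rightarrow> bool" where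
  "first_visit F i c j k \<longleftrightarrow> walk F i c j = k \<and> (\<forall>j'<j. walk F i c j' \<noteq> k)"

text \<open>Before time \<open>j\<close>, row \<open>k\<close> is read only when the walk stands in
  \<open>k\<close>.\<close>

lemma walk_fun_upd:
  "(\<And>j'. j' < j \<Longrightarrow> walk F i c j' \<noteq> k) \<Longrightarrow> walk F i (c(k := r)) j = walk F i c j"
proof (induction j)
  case (Suc j)
  have "walk F i (c(k := r)) j = walk F i c j"
    by (rule Suc.IH) (simp add: Suc.prems)
  moreover have "walk F i c j \<noteq> k" by (rule Suc.prems) simp
  ultimately show ?case by (simp only: walk.simps fun_upd_other not_False_eq_True)
qed simp

text \<open>The event is determined by the rows other than \<open>k\<close>, because row
  \<open>k\<close> is read only after the visit. One implication suffices, as an update can be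
  undone by another one.\<close>

lemma first_visit_fun_upd: "first_visit F i (c(k := r)) j k \<longleftrightarrow> first_visit F i c j k"
proof -
  have *: "first_visit F i (c(k := r)) j k" if "first_visit F i c j k" for c r
  proof -
    have "walk F i (c(k := r)) j' = walk F i c j'" if "j' \<le> j" for j'
      using that \<open>first_visit F i c j k\<close> by (intro walk_fun_upd) (auto simp: first_visit_def)
    with that show ?thesis by (simp add: first_visit_def)
  qed
  from *[of c r] *[of "c(k := r)" "c k"] show ?thesis by auto
qed

text \<open>At its first visit, the row of the final index is independent of all other rows, so it
  may be resampled. This avoids any case distinction on which rows have been read before.\<close>

lemma nn_integral_walk_le:
  fixes g :: "'r \<Rightarrow> 'r \<Rightarrow> ennreal"
  assumes A: "finite A" "i \<in> A" "\<And>j k r. k \<in> A \<Longrightarrow> F j k r \<in> A"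
    and g: "\<And>r'. (\<integral>\<^sup>+ r. g r' r \<partial>measure_pmf \<rho>) \<le> p"
  shows "(\<integral>\<^sup>+ c. (\<Sum>k'\<in>A - {walk F i c n}. g (c k') (c (walk F i c n)))
      \<partial>measure_pmf (Pi_pmf A dflt (\<lambda>_. \<rho>))) \<le> of_nat (Suc n) * (of_nat (card A) * p)"
proof -
  let ?C = "Pi_pmf A dflt (\<lambda>_. \<rho>)"
  \<comment> \<open>The row of the final index is a separate argument \<open>r\<close>, so that it
    can be redrawn while the other rows stay fixed.\<close>
  define S where "S = (\<lambda>c k r. \<Sum>k'\<in>A - {k}. g (c k') r)"
  have walk_in: "walk F i c j \<in> A" for c j
    by (induction j) (auto intro: A)
  \<comment> \<open>The final index was first visited at some time \<open>j \<le> n\<close>; the sum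
    runs over all candidates for this time and index.\<close>
  have "S c (walk F i c n) (c (walk F i c n)) \<le>
      (\<Sum>j\<le>n. \<Sum>k\<in>A. of_bool (first_visit F i c j k) * S c k (c k))" for c
  proof -
    define k where "k = walk F i c n"
    define j where "j = (LEAST j. walk F i c j = k)"
    have "walk F i c j = k" unfolding j_def by (rule LeastI[of _ n]) (simp add: k_def)
    then have "first_visit F i c j k"
      using not_less_Least[of _ "\<lambda>j. walk F i c j = k"] by (auto simp: first_visit_def j_def)
    moreover have "j \<le> n" unfolding j_def by (rule Least_le) (simp add: k_def)
    moreover have "k \<in> A" by (simp add: k_def walk_in)
    ultimately have "S c k (c k) \<le> (\<Sum>k\<in>A. of_bool (first_visit F i c j k) * S c k (c k))"
      using member_le_sum[of k A "\<lambda>k. of_bool (first_visit F i c j k) * S c k (c k)"] A by simp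
    also have "\<dots> \<le> (\<Sum>j\<le>n. \<Sum>k\<in>A. of_bool (first_visit F i c j k) * S c k (c k))"
      using \<open>j \<le> n\<close>
      by (intro member_le_sum[of j _ "\<lambda>j. \<Sum>k\<in>A. of_bool (first_visit F i c j k) * S c k (c k)"]) auto
    finally show ?thesis by (simp add: k_def)
  qed
  then have "(\<integral>\<^sup>+ c. S c (walk F i c n) (c (walk F i c n)) \<partial>?C) \<le>
      (\<integral>\<^sup>+ c. (\<Sum>j\<le>n. \<Sum>k\<in>A. of_bool (first_visit F i c j k) * S c k (c k)) \<partial>?C)"
    by (intro nn_integral_mono) auto
  also have "\<dots> = (\<Sum>j\<le>n. \<Sum>k\<in>A. \<integral>\<^sup>+ c. of_bool (first_visit F i c j k) * S c k (c k) \<partial>?C)"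
    by (simp add: nn_integral_sum)
  also have "\<dots> \<le> (\<Sum>j\<le>n. \<Sum>k\<in>A. \<integral>\<^sup>+ c. of_bool (first_visit F i c j k) * (of_nat (card A) * p) \<partial>?C)"
  proof (intro sum_mono)
    fix j k assume "k \<in> A"
    have S_upd: "S (c(k := r)) k r = S c k r" for c r
      unfolding S_def by (intro sum.cong) auto
    have S_le: "(\<integral>\<^sup>+ r. S c k r \<partial>\<rho>) \<le> of_nat (card A) * p" for c
    proof -
      have "(\<integral>\<^sup>+ r. S c k r \<partial>\<rho>) = (\<Sum>k'\<in>A - {k}. \<integral>\<^sup>+ r. g (c k') r \<partial>\<rho>)"
        unfolding S_def by (simp add: nn_integral_sum)
      also have "\<dots> \<le> (\<Sum>k'\<in>A - {k}. p)" by (intro sum_mono g)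
      also have "\<dots> \<le> (\<Sum>k'\<in>A. p)" using A by (intro sum_mono2) auto
      finally show ?thesis by simp
    qed
    have "(\<integral>\<^sup>+ c. of_bool (first_visit F i c j k) * S c k (c k) \<partial>?C) =
        (\<integral>\<^sup>+ c. of_bool (first_visit F i c j k) * (\<integral>\<^sup>+ r. S c k r \<partial>\<rho>) \<partial>?C)"
      by (subst Pi_pmf_resample[OF \<open>finite A\<close> \<open>k \<in> A\<close>, symmetric])
        (simp add: first_visit_fun_upd S_upd nn_integral_cmult)
    also have "\<dots> \<le> (\<integral>\<^sup>+ c. of_bool (first_visit F i c j k) * (of_nat (card A) * p) \<partial>?C)"
      by (intro nn_integral_mono mult_left_mono S_le) auto
    finally show "(\<integral>\<^sup>+ c. of_bool (first_visit F i c j k) * S c k (c k) \<partial>?C) \<le> \<dots>" .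
  qed
  also have "\<dots> = (\<Sum>j\<le>n. \<integral>\<^sup>+ c. (\<Sum>k\<in>A. of_bool (first_visit F i c j k)) * (of_nat (card A) * p) \<partial>?C)"
    by (simp add: nn_integral_sum sum_distrib_right)
  \<comment> \<open>At each time the walk stands in exactly one index, so summing over
    \<open>k\<close> costs no further factor \<open>card A\<close>.\<close>
  also have "\<dots> \<le> (\<Sum>j\<le>n. \<integral>\<^sup>+ c. 1 * (of_nat (card A) * p) \<partial>?C)"
  proof (intro sum_mono nn_integral_mono mult_right_mono)
    fix j c
    have "(\<Sum>k\<in>A. of_bool (first_visit F i c j k) :: ennreal) \<le> (\<Sum>k\<in>A. of_bool (walk F i c j = k))"
      by (intro sum_mono) (auto simp: first_visit_def)
    also have "\<dots> = 1"
      using A walk_in[of c j] by (simp add: of_bool_def)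
    finally show "(\<Sum>k\<in>A. of_bool (first_visit F i c j k) :: ennreal) \<le> 1" .
  qed auto
  also have "\<dots> = of_nat (Suc n) * (of_nat (card A) * p)"
    by (simp add: measure_pmf.emeasure_space_1)
  finally show ?thesis by (simp add: S_def)
qed

section \<open>Reduction of the transmission to a single block\<close>

lemma finite_messages [simp]: "finite (messages R n)"
  by (simp add: messages_def)

text \<open>Block \<open>b\<close> starts in the last output of the preceding block. Whatever the
  law of that state, the sum over all states dominates, at the price of a constant factor in later
  bounds. Later blocks leave \<open>ys b\<close> unchanged.\<close>

lemma emeasure_transmit_blocks_le:
  fixes Ch :: "'x \<Rightarrow> 'y::finite \<Rightarrow> 'y pmf"
  assumes "b \<in> {1..B}"
  shows "emeasure (transmit_blocks Ch n s xs B) {ys. Q (ys b)} \<le>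
    (\<Sum>s'\<in>UNIV. emeasure (transmit Ch (xs b) s' n) {y. Q y})"
  using assms
proof (induction B)
  case (Suc B)
  show ?case
  proof (cases "b = Suc B")
    case True
    have "emeasure (transmit_blocks Ch n s xs (Suc B)) {ys. Q (ys b)} =
        (\<integral>\<^sup>+ ys. emeasure (transmit Ch (xs b) (ys B n) n) {y. Q y} \<partial>transmit_blocks Ch n s xs B)"
      using True by (simp add: vimage_def flip: map_pmf_def)
    also have "\<dots> \<le> (\<integral>\<^sup>+ ys. (\<Sum>s'\<in>UNIV. emeasure (transmit Ch (xs b) s' n) {y. Q y})
        \<partial>transmit_blocks Ch n s xs B)"
      by (intro nn_integral_mono member_le_sum[of _ UNIV "\<lambda>s'. emeasure (transmit Ch (xs b) s' n) {y. Q y}"]) auto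
    finally show ?thesis by (simp add: measure_pmf.emeasure_space_1)
  next
    case False
    then have "emeasure (transmit_blocks Ch n s xs (Suc B)) {ys. Q (ys b)} =
        (\<integral>\<^sup>+ ys. indicator {ys. Q (ys b)} ys \<partial>transmit_blocks Ch n s xs B)"
      by (simp add: indicator_def measure_pmf.emeasure_space_1)
    with False Suc show ?thesis by simp
  qed
qed simp

text \<open>Summing over all starting states decouples the block from the preceding ones.\<close>

definition ambiguity ::
    "('x \<Rightarrow> 'y::finite \<Rightarrow> 'y pmf) \<Rightarrow> ('u, 'x::finite, 'w, 'y, 'v) letters pmf \<Rightarrow> real \<Rightarrow> nat \<Rightarrow> real \<Rightarrow>
     ('x, 'w) codebook \<Rightarrow> nat \<Rightarrow> ennreal" where
  "ambiguity Ch J R n \<epsilon> c k = (\<Sum>s\<in>UNIV. emeasure (transmit Ch (cb_X c k) s n)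
     {y. \<exists>m'\<in>messages R n. m' \<noteq> k \<and> typical_Y'XY J n \<epsilon> (cb_X c m') y})"

abbreviation source_pmf :: "'u pmf \<Rightarrow> nat \<Rightarrow> (nat \<Rightarrow> 'u) pmf" where
  "source_pmf PU n \<equiv> Pi_pmf {1..n} undefined (\<lambda>_. PU)"

text \<open>Only the event \<open>event_A\<close> is kept. The predicate \<open>G\<close> lets the
  same bound serve the unconditional probability and the one conditioned on the previous
  message.\<close>

lemma emeasure_transmission_confusion_le:
  assumes "b \<in> {2..B}"
  shows "emeasure (transmission_pmf PU Ch J R B n \<epsilon> rule s c)
      {(us, ms, ys). confusion J R n \<epsilon> c ms ys b \<and> G ms} \<le>
    (\<integral>\<^sup>+ us. of_bool (G (message J R n \<epsilon> rule c us)) *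
        ambiguity Ch J R n \<epsilon> c (message J R n \<epsilon> rule c us b)
      \<partial>Pi_pmf {1..B} undefined (\<lambda>_. source_pmf PU n))"
proof -
  have "emeasure (transmit_blocks Ch n s (\<lambda>b. cb_X c (ms b)) B)
      {ys. confusion J R n \<epsilon> c ms ys b \<and> G ms} \<le> of_bool (G ms) * ambiguity Ch J R n \<epsilon> c (ms b)" for ms
  proof (cases "G ms")
    case True
    have "emeasure (transmit_blocks Ch n s (\<lambda>b. cb_X c (ms b)) B)
        {ys. confusion J R n \<epsilon> c ms ys b \<and> G ms} \<le>
      emeasure (transmit_blocks Ch n s (\<lambda>b. cb_X c (ms b)) B)
        {ys. \<exists>m'\<in>messages R n. m' \<noteq> ms b \<and> typical_Y'XY J n \<epsilon> (cb_X c m') (ys b)}"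
      by (intro emeasure_mono) (auto simp: confusion_def event_A_def)
    also have "\<dots> \<le> ambiguity Ch J R n \<epsilon> c (ms b)"
      unfolding ambiguity_def by (rule emeasure_transmit_blocks_le) (use assms in auto)
    finally show ?thesis using True by simp
  qed simp
  then show ?thesis
    unfolding transmission_pmf_def
    by (auto simp: Let_def vimage_def simp flip: map_pmf_def intro!: nn_integral_mono)
qed

lemma message_cong:
  "(\<And>j. j < b \<Longrightarrow> us j = us' j) \<Longrightarrow> message J R n \<epsilon> rule c us b = message J R n \<epsilon> rule c us' b"
proof (induction b rule: induct_nat_012)
  case (ge2 b)
  have "message J R n \<epsilon> rule c us (Suc b) = message J R n \<epsilon> rule c us' (Suc b)"
    by (rule ge2.IH) (simp add: ge2.prems)
  moreover have "us (Suc b) = us' (Suc b)" by (rule ge2.prems) simp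
  ultimately show ?case by simp
qed auto

text \<open>For a fixed codebook the message of block \<open>b - 1\<close> is a function of source
  blocks before \<open>b - 1\<close>. Hence block \<open>b - 1\<close> of the source keeps its law
  under the conditioning.\<close>

lemma cond_prob_confusion_le:
  assumes b: "b \<in> {2..B}"
  shows "ennreal (\<P>((us, ms, ys) in measure_pmf (transmission_pmf PU Ch J R B n \<epsilon> rule s c).
      confusion J R n \<epsilon> c ms ys b \<bar> ms (b - 1) = m)) \<le>
    (\<integral>\<^sup>+ u. ambiguity Ch J R n \<epsilon> c (encode J R n \<epsilon> rule c m u) \<partial>source_pmf PU n)"
    (is "_ \<le> ?X")
proof -
  let ?T = "transmission_pmf PU Ch J R B n \<epsilon> rule s c"
  let ?U = "Pi_pmf {1..B} undefined (\<lambda>_. source_pmf PU n)"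
  let ?msg = "message J R n \<epsilon> rule c"
  let ?amb = "ambiguity Ch J R n \<epsilon> c"
  have msg_b: "?msg us b = encode J R n \<epsilon> rule c (?msg us (b - 1)) (us (b - 1))" for us
  proof -
    obtain j where "b = Suc (Suc j)" using b by (auto dest!: le_Suc_ex simp: numeral_2_eq_2)
    then show ?thesis by simp
  qed
  have msg_upd: "?msg (us(b - 1 := u)) (b - 1) = ?msg us (b - 1)" for us u
    by (rule message_cong) auto
  have cond: "emeasure ?T {(us, ms, ys). ms (b - 1) = m} = (\<integral>\<^sup>+ us. of_bool (?msg us (b - 1) = m) \<partial>?U)"
    unfolding transmission_pmf_def
    by (auto simp: Let_def vimage_def measure_pmf.emeasure_space_1 simp flip: map_pmf_def
        intro!: nn_integral_cong)
  have "emeasure ?T {(us, ms, ys). confusion J R n \<epsilon> c ms ys b \<and> ms (b - 1) = m} \<le>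
      (\<integral>\<^sup>+ us. of_bool (?msg us (b - 1) = m) * ?amb (?msg us b) \<partial>?U)"
    by (rule emeasure_transmission_confusion_le[OF b])
  also have "\<dots> = (\<integral>\<^sup>+ us. of_bool (?msg us (b - 1) = m) * ?amb (encode J R n \<epsilon> rule c m (us (b - 1))) \<partial>?U)"
    by (intro nn_integral_cong) (auto simp: msg_b)
  \<comment> \<open>Redrawing source block \<open>b - 1\<close> leaves the indicator alone and
    integrates the other factor; \<open>b \<ge> 2\<close> puts \<open>b - 1\<close> in the index
    set.\<close>
  also have "\<dots> = (\<integral>\<^sup>+ us. of_bool (?msg us (b - 1) = m) * ?X \<partial>?U)"
    by (subst Pi_pmf_resample[of _ "b - 1", symmetric])
      (use b in \<open>auto simp: msg_upd[unfolded One_nat_def] nn_integral_cmult\<close>)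
  also have "\<dots> = ?X * emeasure ?T {(us, ms, ys). ms (b - 1) = m}"
    unfolding cond by (simp add: nn_integral_multc mult.commute)
  finally have le: "emeasure ?T {(us, ms, ys). confusion J R n \<epsilon> c ms ys b \<and> ms (b - 1) = m} \<le>
      ?X * emeasure ?T {(us, ms, ys). ms (b - 1) = m}" .
  have *: "{\<omega>. (case \<omega> of (us, ms, ys) \<Rightarrow> confusion J R n \<epsilon> c ms ys b) \<and> (case \<omega> of (us, ms, ys) \<Rightarrow> ms (b - 1) = m)}
      = {(us, ms, ys). confusion J R n \<epsilon> c ms ys b \<and> ms (b - 1) = m}" by auto
  show ?thesis
  proof (cases "measure ?T {(us, ms, ys). ms (b - 1) = m} = 0")
    case False
    then have "measure ?T {(us, ms, ys). ms (b - 1) = m} > 0"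
      by (simp add: zero_less_measure_iff)
    moreover from this have "emeasure ?T {(us, ms, ys). confusion J R n \<epsilon> c ms ys b \<and> ms (b - 1) = m} /
        emeasure ?T {(us, ms, ys). ms (b - 1) = m} \<le> ?X"
      using le by (intro divide_le_posI_ennreal) (auto simp: measure_pmf.emeasure_eq_measure mult.commute)
    ultimately show ?thesis
      by (simp add: cond_prob_def *[unfolded One_nat_def] measure_pmf.emeasure_eq_measure divide_ennreal)
  qed (simp add: cond_prob_def)
qed

text \<open>The union bound over wrong messages, shaped as the sum over pairs of rows in
  \<open>nn_integral_walk_le\<close>.\<close>

lemma ambiguity_le:
  "ambiguity Ch J R n \<epsilon> c k \<le> (\<Sum>m'\<in>messages R n - {k}. \<Sum>s\<in>UNIV.
     emeasure (transmit Ch (fst (c k)) s n) {y. typical_Y'XY J n \<epsilon> (fst (c m')) y})"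
proof -
  have "emeasure (transmit Ch (cb_X c k) s n)
      {y. \<exists>m'\<in>messages R n. m' \<noteq> k \<and> typical_Y'XY J n \<epsilon> (cb_X c m') y} \<le>
    (\<Sum>m'\<in>messages R n - {k}. emeasure (transmit Ch (fst (c k)) s n) {y. typical_Y'XY J n \<epsilon> (fst (c m')) y})"
    for s
  proof -
    have "{y. \<exists>m'\<in>messages R n. m' \<noteq> k \<and> typical_Y'XY J n \<epsilon> (cb_X c m') y} =
        (\<Union>m'\<in>messages R n - {k}. {y. typical_Y'XY J n \<epsilon> (fst (c m')) y})"
      by (auto simp: cb_X_def)
    then show ?thesis
      by (simp add: cb_X_def) (rule emeasure_subadditive_finite, auto)
  qed
  then show ?thesis
    unfolding ambiguity_def by (subst sum.swap) (rule sum_mono)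
qed

section \<open>The encoder as a walk on codebook rows\<close>

text \<open>Walks count from 0 and messages from 1: step \<open>j\<close> leads from message
  \<open>j + 1\<close> to message \<open>j + 2\<close> and uses source block
  \<open>j + 1\<close>.\<close>

definition encoder_step ::
    "('u::finite, 'x::finite, 'w::finite, 'y, 'v) letters pmf \<Rightarrow> real \<Rightarrow> nat \<Rightarrow> real \<Rightarrow>
     ('u, 'x, 'w) rule \<Rightarrow> (nat \<Rightarrow> nat \<Rightarrow> 'u) \<Rightarrow> nat \<Rightarrow> nat \<Rightarrow> ('x, 'w) row \<Rightarrow> nat" where
  "encoder_step J R n \<epsilon> rule us j k r = rule n k (us (Suc j)) r
     {m' \<in> messages R n. typical_UXW J n \<epsilon> (us (Suc j)) (fst r) (snd r m')}"

lemma encode_eq: "encode J R n \<epsilon> rule c k (us (Suc j)) = encoder_step J R n \<epsilon> rule us j k (c k)"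
  by (simp add: encode_def encoder_step_def admissible_def cb_X_def cb_W_def)

lemma message_eq_walk:
  "message J R n \<epsilon> rule c us (Suc j) = walk (encoder_step J R n \<epsilon> rule us) 1 c j"
  by (induction j) (simp_all add: encode_eq)

lemma encoder_step_in_messages:
  assumes "valid_rule R rule"
  shows "encoder_step J R n \<epsilon> rule us j k r \<in> messages R n"
proof -
  let ?S = "{m' \<in> messages R n. typical_UXW J n \<epsilon> (us (Suc j)) (fst r) (snd r m')}"
  have "encoder_step J R n \<epsilon> rule us j k r \<in> (if ?S = {} then messages R n else ?S)"
    unfolding encoder_step_def by (rule assms[unfolded valid_rule_def, rule_format]) auto
  also have "\<dots> \<subseteq> messages R n" by auto
  finally show ?thesis .
qed

text \<open>The ambiguity sees a row only through its \<open>X\<close> codeword, which is i.i.d.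
  under \<open>row_pmf\<close>, so the typicality bound \<open>p\<close> applies to a resampled row.
  The start \<open>m\<close> is free to cover both the whole message process and a single step from
  a given message.\<close>

lemma nn_integral_ambiguity_walk_le:
  fixes Ch :: "'x::finite \<Rightarrow> 'y::finite \<Rightarrow> 'y pmf"
  assumes "valid_rule R rule" "m \<in> messages R n"
    and p: "\<And>s x. emeasure (bind_pmf (Pi_pmf {1..n} undefined (\<lambda>_. PX)) (\<lambda>x'. transmit Ch x' s n))
      {y. typical_Y'XY J n \<epsilon> x y} \<le> p"
  shows "(\<integral>\<^sup>+ c. ambiguity Ch J R n \<epsilon> c (walk (encoder_step J R n \<epsilon> rule us) m c j)
      \<partial>codebook_pmf PX J R n) \<le>
    of_nat (Suc j) * (of_nat (card (messages R n)) * (of_nat CARD('y) * p))"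
  (is "_ \<le> ?r")
proof -
  let ?w = "walk (encoder_step J R n \<epsilon> rule us) m"
  let ?g = "\<lambda>r' r. \<Sum>s\<in>UNIV. emeasure (transmit Ch (fst r) s n) {y. typical_Y'XY J n \<epsilon> (fst r') y}"
  have "(\<integral>\<^sup>+ c. ambiguity Ch J R n \<epsilon> c (?w c j) \<partial>codebook_pmf PX J R n) \<le>
      (\<integral>\<^sup>+ c. (\<Sum>m'\<in>messages R n - {?w c j}. ?g (c m') (c (?w c j))) \<partial>codebook_pmf PX J R n)"
    by (intro nn_integral_mono ambiguity_le)
  also have "\<dots> \<le> ?r"
    unfolding codebook_pmf_def
  proof (rule nn_integral_walk_le)
    fix r' :: "('x, 'b) row"
    have "(\<integral>\<^sup>+ r. ?g r' r \<partial>row_pmf PX J R n) = (\<Sum>s\<in>UNIV.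
        emeasure (bind_pmf (Pi_pmf {1..n} undefined (\<lambda>_. PX)) (\<lambda>x'. transmit Ch x' s n))
          {y. typical_Y'XY J n \<epsilon> (fst r') y})"
      by (simp add: row_pmf_def nn_integral_sum measure_pmf.emeasure_space_1)
    also have "\<dots> \<le> (\<Sum>s\<in>(UNIV :: 'y set). p)" by (intro sum_mono p)
    finally show "(\<integral>\<^sup>+ r. ?g r' r \<partial>row_pmf PX J R n) \<le> of_nat CARD('y) * p" by simp
  qed (use assms in \<open>auto simp: encoder_step_in_messages\<close>)
  finally show ?thesis .
qed

section \<open>Asymptotics and conclusion\<close>

lemma nn_integral_pmf_swap:
  "(\<integral>\<^sup>+ x. \<integral>\<^sup>+ y. f x y \<partial>measure_pmf q \<partial>measure_pmf p) = (\<integral>\<^sup>+ y. \<integral>\<^sup>+ x. f x y \<partial>measure_pmf p \<partial>measure_pmf q)"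
proof -
  have "(\<integral>\<^sup>+ x. \<integral>\<^sup>+ y. f x y \<partial>measure_pmf q \<partial>measure_pmf p) = (\<integral>\<^sup>+ z. f (fst z) (snd z) \<partial>pair_pmf p q)"
    by (simp add: nn_integral_pair_pmf')
  also have "\<dots> = (\<integral>\<^sup>+ y. \<integral>\<^sup>+ x. f x y \<partial>measure_pmf p \<partial>measure_pmf q)"
    by (subst pair_commute_pmf) (simp add: nn_integral_pair_pmf' case_prod_unfold)
  finally show ?thesis .
qed

lemma expectation_leI:
  fixes f :: "'a \<Rightarrow> real"
  assumes "\<And>c. f c \<ge> 0" "(\<integral>\<^sup>+ c. ennreal (f c) \<partial>measure_pmf p) \<le> ennreal e" "e \<ge> 0"
  shows "measure_pmf.expectation p f \<le> e"
  using assms by (subst integral_eq_nn_integral) (auto intro: enn2real_leI)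

text \<open>The rate stays \<delta> below \<open>I\<close> but the exponent only \<delta>/2, which
  leaves a geometric decay that beats the constants \<open>b\<close> and \<open>d\<close>.\<close>

lemma eventually_messages_bound:
  assumes "R \<le> I - \<delta>" "\<delta> > 0" "R > 0" "\<eta> > 0"
  shows "\<forall>\<^sub>F n in sequentially. b * (real (card (messages R n)) * (d * 2 powr - (real n * (I - \<delta> / 2)))) \<le> \<eta>"
proof -
  have "(\<lambda>n. 2 * \<bar>b * d\<bar> * (2 powr (- \<delta> / 2)) ^ n) \<longlonglongrightarrow> 2 * \<bar>b * d\<bar> * 0"
    using powr_less_mono[of "- \<delta> / 2" 0 2] assms
    by (intro tendsto_mult tendsto_const LIMSEQ_realpow_zero) auto
  then have "\<forall>\<^sub>F n in sequentially. 2 * \<bar>b * d\<bar> * (2 powr (- \<delta> / 2)) ^ n < \<eta>"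
    using assms by (intro order_tendstoD) auto
  then show ?thesis
  proof eventually_elim
    case (elim n)
    \<comment> \<open>The factor 2 absorbs the rounding up of the number of messages.\<close>
    have "2 powr (real n * R) \<ge> 1" using assms by (simp add: ge_one_powr_ge_zero)
    then have "real (card (messages R n)) \<le> 2 * 2 powr (real n * R)"
      unfolding messages_def by simp linarith
    then have "real (card (messages R n)) * 2 powr - (real n * (I - \<delta> / 2)) \<le>
        2 * 2 powr (real n * R) * 2 powr - (real n * (I - \<delta> / 2))"
      by (intro mult_right_mono) auto
    also have "\<dots> = 2 * 2 powr (real n * (R - I + \<delta> / 2))"
      by (simp add: algebra_simps flip: powr_add)
    also have "\<dots> \<le> 2 * 2 powr (real n * (- \<delta> / 2))"
      using assms by (intro mult_left_mono powr_mono mult_left_mono) auto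
    also have "\<dots> = 2 * (2 powr (- \<delta> / 2)) ^ n"
      by (simp add: powr_powr mult.commute flip: powr_realpow)
    finally have "\<bar>b * d\<bar> * (real (card (messages R n)) * 2 powr - (real n * (I - \<delta> / 2))) \<le>
        \<bar>b * d\<bar> * (2 * (2 powr (- \<delta> / 2)) ^ n)"
      by (intro mult_left_mono) auto
    moreover have "b * d * (real (card (messages R n)) * 2 powr - (real n * (I - \<delta> / 2))) \<le>
        \<bar>b * d\<bar> * (real (card (messages R n)) * 2 powr - (real n * (I - \<delta> / 2)))"
      by (intro mult_right_mono) auto
    ultimately show ?case using elim by (simp add: mult_ac)
  qed
qed

text \<open>The typicality parameter \<epsilon> and the probability bound \<eta> are separate:
  \<epsilon> has to be small against \<delta>, whereas \<eta> is arbitrary. The bound is given both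
  without conditioning and given each value of the previous message.\<close>

theorem lemma2:
  fixes PU :: "'u::finite pmf"
    and PX :: "'x::finite pmf"
    and PW :: "'u \<Rightarrow> 'x \<Rightarrow> 'w::finite pmf"
    and \<pi> :: "'y::finite pmf"
    and Ch :: "'x \<Rightarrow> 'y \<Rightarrow> 'y pmf"
    and PV :: "'y \<Rightarrow> 'x \<Rightarrow> 'w \<Rightarrow> 'v::finite pmf"
    and \<delta> R :: real
    and B b :: nat
  defines "J \<equiv> joint_pmf PU PX PW \<pi> Ch PV"
  assumes "\<And>P :: 'x pmf. unichain (mean_kernel Ch P)"
    and "equilibrium (mean_kernel Ch PX) \<pi>"
    and "cond_info J pr_X pr_Y pr_Y' - cond_info J pr_U pr_W pr_X \<ge> 0"
    and "\<delta> > 0" and "R > 0"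
    and "R \<ge> cond_info J pr_U pr_W pr_X + \<delta>"
    and "R \<le> cond_info J pr_X pr_Y pr_Y' - \<delta>"
    and "b \<in> {2..B}"
  shows "\<exists>\<epsilon>\<^sub>0>0. \<forall>\<epsilon>. 0 < \<epsilon> \<and> \<epsilon> \<le> \<epsilon>\<^sub>0 \<longrightarrow>
    (\<forall>rule. valid_rule R rule \<longrightarrow> (\<forall>\<eta>>0. \<exists>N\<^sub>0. \<forall>n\<ge>N\<^sub>0. \<forall>s.
      measure_pmf.expectation (codebook_pmf PX J R n)
        (\<lambda>c. \<P>((us, ms, ys) in measure_pmf (transmission_pmf PU Ch J R B n \<epsilon> rule s c).
               confusion J R n \<epsilon> c ms ys b)) \<le> \<eta> \<and>
      (\<forall>m\<in>messages R n.
        measure_pmf.expectation (codebook_pmf PX J R n)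
          (\<lambda>c. \<P>((us, ms, ys) in measure_pmf (transmission_pmf PU Ch J R B n \<epsilon> rule s c).
                 confusion J R n \<epsilon> c ms ys b \<bar> ms (b - 1) = m)) \<le> \<eta>)))"
proof -
  let ?I = "cond_info J pr_X pr_Y pr_Y'"
  note \<delta> = \<open>\<delta> > 0\<close> and R = \<open>R > 0\<close> \<open>R \<le> ?I - \<delta>\<close> and b = \<open>b \<in> {2..B}\<close>
  \<comment> \<open>Half of the margin goes into the typicality bound; the other half has to beat
    the number of messages.\<close>
  from \<delta> have "\<delta> / 2 > 0" by simp
  from ex_typicality_bound[OF this, where PU = PU and PX = PX and PW = PW and \<pi> = \<pi> and Ch = Ch and PV = PV,
      folded J_def]
  obtain \<epsilon>\<^sub>0 where "\<epsilon>\<^sub>0 > 0" and \<epsilon>\<^sub>0: "\<And>\<epsilon> n s x. \<epsilon> \<le> \<epsilon>\<^sub>0 \<Longrightarrow>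
      emeasure (bind_pmf (Pi_pmf {1..n} undefined (\<lambda>_. PX)) (\<lambda>x'. transmit Ch x' s n))
        {y. typical_Y'XY J n \<epsilon> x y} \<le> ennreal (2 powr - (real n * (?I - \<delta> / 2)))"
    by blast
  show ?thesis
  proof (intro exI[of _ \<epsilon>\<^sub>0] conjI allI impI)
    fix \<epsilon> \<eta> :: real and rule :: "('u, 'x, 'w) rule"
    assume "0 < \<epsilon> \<and> \<epsilon> \<le> \<epsilon>\<^sub>0" and rule: "valid_rule R rule" and "\<eta> > 0"
    then have "\<epsilon> \<le> \<epsilon>\<^sub>0" by simp
    \<comment> \<open>The factors count the times of a first visit, the competing messages and the
      starting states.\<close>
    let ?b = "\<lambda>n. real b * (real (card (messages R n)) * (real CARD('y) * 2 powr - (real n * (?I - \<delta> / 2))))"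
    obtain N where N: "?b n \<le> \<eta>" if "n \<ge> N" for n
      using eventually_messages_bound[OF R(2) \<delta> R(1) \<open>\<eta> > 0\<close>, of "real b" "real CARD('y)"]
      unfolding eventually_sequentially by blast
    have walk_le: "(\<integral>\<^sup>+ c. ambiguity Ch J R n \<epsilon> c (walk (encoder_step J R n \<epsilon> rule us) m c j)
        \<partial>codebook_pmf PX J R n) \<le> ennreal \<eta>"
      if "n \<ge> N" "m \<in> messages R n" "Suc j \<le> b" for n m us j
    proof -
      have "(\<integral>\<^sup>+ c. ambiguity Ch J R n \<epsilon> c (walk (encoder_step J R n \<epsilon> rule us) m c j)
          \<partial>codebook_pmf PX J R n) \<le>
        of_nat (Suc j) * (of_nat (card (messages R n)) *
          (of_nat CARD('y) * ennreal (2 powr - (real n * (?I - \<delta> / 2)))))"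
        by (rule nn_integral_ambiguity_walk_le[OF rule that(2) \<epsilon>\<^sub>0[OF \<open>\<epsilon> \<le> \<epsilon>\<^sub>0\<close>]])
      also have "\<dots> \<le> of_nat b * (of_nat (card (messages R n)) *
          (of_nat CARD('y) * ennreal (2 powr - (real n * (?I - \<delta> / 2)))))"
        using that(3) by (intro mult_right_mono) (auto simp del: of_nat_Suc)
      also have "\<dots> = ennreal (?b n)"
        by (simp add: ennreal_mult flip: ennreal_of_nat_eq_real_of_nat)
      also have "\<dots> \<le> ennreal \<eta>" by (intro ennreal_leI N that)
      finally show ?thesis .
    qed
    show "\<exists>N\<^sub>0. \<forall>n\<ge>N\<^sub>0. \<forall>s.
      measure_pmf.expectation (codebook_pmf PX J R n)
        (\<lambda>c. \<P>((us, ms, ys) in measure_pmf (transmission_pmf PU Ch J R B n \<epsilon> rule s c).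
               confusion J R n \<epsilon> c ms ys b)) \<le> \<eta> \<and>
      (\<forall>m\<in>messages R n.
        measure_pmf.expectation (codebook_pmf PX J R n)
          (\<lambda>c. \<P>((us, ms, ys) in measure_pmf (transmission_pmf PU Ch J R B n \<epsilon> rule s c).
                 confusion J R n \<epsilon> c ms ys b \<bar> ms (b - 1) = m)) \<le> \<eta>)"
    proof (intro exI[of _ N] allI impI conjI ballI expectation_leI)
      fix n s assume "n \<ge> N"
      have "1 \<in> messages R n"
      proof -
        have "2 powr (real n * R) \<ge> 1" using R by (simp add: ge_one_powr_ge_zero)
        then show ?thesis by (simp add: messages_def) linarith
      qed
      let ?U = "Pi_pmf {1..B} undefined (\<lambda>_. source_pmf PU n)"
      have "ennreal (\<P>((us, ms, ys) in measure_pmf (transmission_pmf PU Ch J R B n \<epsilon> rule s c).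
          confusion J R n \<epsilon> c ms ys b)) \<le>
        (\<integral>\<^sup>+ us. ambiguity Ch J R n \<epsilon> c (message J R n \<epsilon> rule c us b) \<partial>?U)" for c
        using emeasure_transmission_confusion_le[OF b, where G = "\<lambda>_. True", of PU Ch J R n \<epsilon> rule s c]
        by (simp add: measure_pmf.emeasure_eq_measure)
      then have "(\<integral>\<^sup>+ c. ennreal (\<P>((us, ms, ys) in measure_pmf (transmission_pmf PU Ch J R B n \<epsilon> rule s c).
          confusion J R n \<epsilon> c ms ys b)) \<partial>codebook_pmf PX J R n) \<le>
        (\<integral>\<^sup>+ c. \<integral>\<^sup>+ us. ambiguity Ch J R n \<epsilon> c (message J R n \<epsilon> rule c us b) \<partial>?U \<partial>codebook_pmf PX J R n)"
        by (intro nn_integral_mono)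
      \<comment> \<open>The codebook is averaged first, for fixed source blocks, because the walk
        bound is uniform in \<open>us\<close>.\<close>
      also have "\<dots> = (\<integral>\<^sup>+ us. \<integral>\<^sup>+ c. ambiguity Ch J R n \<epsilon> c (message J R n \<epsilon> rule c us b)
          \<partial>codebook_pmf PX J R n \<partial>?U)"
        by (rule nn_integral_pmf_swap)
      also have "\<dots> \<le> (\<integral>\<^sup>+ us. ennreal \<eta> \<partial>?U)"
      proof (rule nn_integral_mono)
        fix us
        show "(\<integral>\<^sup>+ c. ambiguity Ch J R n \<epsilon> c (message J R n \<epsilon> rule c us b) \<partial>codebook_pmf PX J R n) \<le> ennreal \<eta>"
          using walk_le[OF \<open>n \<ge> N\<close> \<open>1 \<in> messages R n\<close>, of "b - 1" us] b
          by (simp add: message_eq_walk[symmetric, unfolded One_nat_def])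
      qed
      finally show "(\<integral>\<^sup>+ c. ennreal (\<P>((us, ms, ys) in measure_pmf (transmission_pmf PU Ch J R B n \<epsilon> rule s c).
          confusion J R n \<epsilon> c ms ys b)) \<partial>codebook_pmf PX J R n) \<le> ennreal \<eta>"
        by (simp add: measure_pmf.emeasure_space_1)
    next
      fix n s m assume "n \<ge> N" "m \<in> messages R n"
      have "(\<integral>\<^sup>+ c. ennreal (\<P>((us, ms, ys) in measure_pmf (transmission_pmf PU Ch J R B n \<epsilon> rule s c).
          confusion J R n \<epsilon> c ms ys b \<bar> ms (b - 1) = m)) \<partial>codebook_pmf PX J R n) \<le>
        (\<integral>\<^sup>+ c. \<integral>\<^sup>+ u. ambiguity Ch J R n \<epsilon> c (encode J R n \<epsilon> rule c m u) \<partial>source_pmf PU n \<partial>codebook_pmf PX J R n)"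
        by (intro nn_integral_mono cond_prob_confusion_le b)
      also have "\<dots> = (\<integral>\<^sup>+ u. \<integral>\<^sup>+ c. ambiguity Ch J R n \<epsilon> c (encode J R n \<epsilon> rule c m u)
          \<partial>codebook_pmf PX J R n \<partial>source_pmf PU n)"
        by (rule nn_integral_pmf_swap)
      also have "\<dots> \<le> (\<integral>\<^sup>+ u. ennreal \<eta> \<partial>source_pmf PU n)"
      proof (rule nn_integral_mono)
        fix u
        \<comment> \<open>A walk of one step reads only source block 1, so a constant family of
          blocks will do.\<close>
        have "encode J R n \<epsilon> rule c m u = walk (encoder_step J R n \<epsilon> rule (\<lambda>_. u)) m c 1" for c
          using encode_eq[of J R n \<epsilon> rule c m "\<lambda>_. u" 0] by simp
        then show "(\<integral>\<^sup>+ c. ambiguity Ch J R n \<epsilon> c (encode J R n \<epsilon> rule c m u) \<partial>codebook_pmf PX J R n) \<le> ennreal \<eta>"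
          using walk_le[OF \<open>n \<ge> N\<close> \<open>m \<in> messages R n\<close>, of 1 "\<lambda>_. u"] b
          by (simp del: walk.simps)
      qed
      finally show "(\<integral>\<^sup>+ c. ennreal (\<P>((us, ms, ys) in measure_pmf (transmission_pmf PU Ch J R B n \<epsilon> rule s c).
          confusion J R n \<epsilon> c ms ys b \<bar> ms (b - 1) = m)) \<partial>codebook_pmf PX J R n) \<le> ennreal \<eta>"
        by (simp add: measure_pmf.emeasure_space_1)
    qed (use \<open>\<eta> > 0\<close> in \<open>auto simp: cond_prob_def\<close>)
  qed (fact \<open>\<epsilon>\<^sub>0 > 0\<close>)
qed

end
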